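(* Let $Y$ be a path connected metric space and let $y_0\in Y$ be such that the topological fundamental group $\pi_1^{top}(Y,y_0)$ is metrizable. Then the Hawaiian earring $HE$ cannot be embedded as a retract of $Y$; that is, there is no subspace $A\subset Y$ homeomorphic to $HE$ for which there exists a continuous map $r:Y\to A$ with $r(a)=a$ for all $a\in A$.
   Context: The Hawaiian earring is $HE=\bigcup_{n=1}^{\infty}X_n\subset\mathbb{R}^2$ with the subspace topology, where $X_n$ is the circle of radius $\frac1n$ centered at $(\frac1n,0)$. For a metric space $X$ and $p\in X$, let $C_p(X)=\{f:[0,1]\to X \mid f \text{ is continuous and } f(0)=f(1)=p\}$, endowed with the topology of uniform convergence. The topological fundamental group $\pi_1^{top}(X,p)$ is the set of path components of $C_p(X)$, endowed with the quotient topology under the canonical surjection $\Pi:C_p(X)\to\pi_1^{top}(X,p)$, where $\Pi(f)=\Pi(g)$ if and only if $f$ and $g$ belong to the same path component of $C_p(X)$. Thus $U\subset\pi_1^{top}(X,p)$ is open if and only if $\Pi^{-1}(U)$ is open in $C_p(X)$. A topological space is metrizable if its topology is induced by some metric. *)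

theory Defs
  imports "HOL-Analysis.Analysis"
begin

definition hawaiian_earring :: "(real \<times> real) set" where
  "hawaiian_earring = (\<Union>n\<in>{1::nat..}. sphere (1 / real n, 0) (1 / real n))"

(* A map defined on the unit interval only is represented by a function that takes the value
   undefined outside the interval, so that loops agreeing on the interval are equal. *)
definition loops_at :: "'a metric \<Rightarrow> 'a \<Rightarrow> (real \<Rightarrow> 'a) set" where
  "loops_at m p =
     {f \<in> extensional {0..1}. pathin (mtopology_of m) f \<and> f 0 = p \<and> f 1 = p}"

definition uniform_open :: "'a metric \<Rightarrow> 'a \<Rightarrow> (real \<Rightarrow> 'a) set \<Rightarrow> bool" where
  "uniform_open m p U \<longleftrightarrow> U \<subseteq> loops_at m p \<and>
     (\<forall>f\<in>U. \<exists>e>0. \<forall>g\<in>loops_at m p. (\<forall>t\<in>{0..1}. mdist m (f t) (g t) < e) \<longrightarrow> g \<in> U)"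

lemma istopology_uniform_open: "istopology (uniform_open m p)"
  unfolding istopology_def
proof (intro conjI allI impI)
  fix S T
  assume S: "uniform_open m p S" and T: "uniform_open m p T"
  show "uniform_open m p (S \<inter> T)"
    unfolding uniform_open_def
  proof (intro conjI ballI)
    show "S \<inter> T \<subseteq> loops_at m p"
      using S by (auto simp: uniform_open_def)
    fix f assume f: "f \<in> S \<inter> T"
    obtain d where d: "d > 0"
      "\<And>g. g \<in> loops_at m p \<Longrightarrow> \<forall>t\<in>{0..1}. mdist m (f t) (g t) < d \<Longrightarrow> g \<in> S"
      using S f unfolding uniform_open_def by blast
    obtain e where e: "e > 0"
      "\<And>g. g \<in> loops_at m p \<Longrightarrow> \<forall>t\<in>{0..1}. mdist m (f t) (g t) < e \<Longrightarrow> g \<in> T"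
      using T f unfolding uniform_open_def by blast
    show "\<exists>e>0. \<forall>g\<in>loops_at m p.
            (\<forall>t\<in>{0..1}. mdist m (f t) (g t) < e) \<longrightarrow> g \<in> S \<inter> T"
      using d e by (intro exI[of _ "min d e"]) auto
  qed
next
  fix K
  assume "\<forall>S\<in>K. uniform_open m p S"
  then show "uniform_open m p (\<Union>K)"
    unfolding uniform_open_def by (meson Sup_least Union_iff)
qed

(* topology of uniform convergence *)
definition loop_space :: "'a metric \<Rightarrow> 'a \<Rightarrow> (real \<Rightarrow> 'a) topology" where
  "loop_space m p = topology (uniform_open m p)"

lemma openin_loop_space: "openin (loop_space m p) = uniform_open m p"
  by (simp add: loop_space_def istopology_uniform_open)

lemma topspace_loop_space [simp]: "topspace (loop_space m p) = loops_at m p"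
proof -
  have "uniform_open m p (loops_at m p)"
    unfolding uniform_open_def using zero_less_one by blast
  then show ?thesis
    by (metis openin_loop_space openin_subset openin_topspace subset_antisym uniform_open_def)
qed

definition pi1_open :: "'a metric \<Rightarrow> 'a \<Rightarrow> (real \<Rightarrow> 'a) set set \<Rightarrow> bool" where
  "pi1_open m p U \<longleftrightarrow> U \<subseteq> path_components_of (loop_space m p) \<and>
     openin (loop_space m p)
       {f \<in> topspace (loop_space m p). path_component_of_set (loop_space m p) f \<in> U}"

lemma istopology_pi1_open: "istopology (pi1_open m p)"
  unfolding istopology_def
proof (intro conjI allI impI)
  let ?L = "loop_space m p"
  let ?P = "\<lambda>U. {f \<in> topspace ?L. path_component_of_set ?L f \<in> U}"
  fix S T
  assume "pi1_open m p S" "pi1_open m p T"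
  moreover have "?P (S \<inter> T) = ?P S \<inter> ?P T"
    by blast
  ultimately show "pi1_open m p (S \<inter> T)"
    unfolding pi1_open_def by (metis (no_types, lifting) inf.coboundedI1 openin_Int)
next
  let ?L = "loop_space m p"
  let ?P = "\<lambda>U. {f \<in> topspace ?L. path_component_of_set ?L f \<in> U}"
  fix K
  assume K: "\<forall>S\<in>K. pi1_open m p S"
  have "?P (\<Union>K) = (\<Union>S\<in>K. ?P S)"
    by blast
  moreover have "openin ?L (\<Union>S\<in>K. ?P S)"
    using K by (intro openin_Union) (auto simp: pi1_open_def)
  moreover have "\<Union>K \<subseteq> path_components_of ?L"
    using K by (auto simp: pi1_open_def)
  ultimately show "pi1_open m p (\<Union>K)"
    unfolding pi1_open_def by simp
qed

definition pi1_top :: "'a metric \<Rightarrow> 'a \<Rightarrow> (real \<Rightarrow> 'a) set topology" where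
  "pi1_top m p = topology (pi1_open m p)"

lemma openin_pi1_top: "openin (pi1_top m p) = pi1_open m p"
  by (simp add: pi1_top_def istopology_pi1_open)

lemma topspace_pi1_top [simp]:
  "topspace (pi1_top m p) = path_components_of (loop_space m p)"
proof -
  let ?L = "loop_space m p"
  have "{f \<in> topspace ?L. path_component_of_set ?L f \<in> path_components_of ?L} = topspace ?L"
    by (auto simp: path_components_of_def)
  then have "pi1_open m p (path_components_of ?L)"
    unfolding pi1_open_def by (metis openin_topspace order_refl)
  then show ?thesis
    by (metis openin_pi1_top openin_subset openin_topspace pi1_open_def subset_antisym)
qed

lemma quotient_map_pi1_top:
  "quotient_map (loop_space m p) (pi1_top m p) (path_component_of_set (loop_space m p))"
  unfolding quotient_map_def openin_pi1_top topspace_pi1_top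
  by (auto simp: path_components_of_def pi1_open_def)

end

theory Submission
  imports Defs
begin

text \<open>
  Let x_n be the loop running once around the n-th circle of the earring inside Y, and let g be a
  path from y0 to the wedge point. The loops w(m,n) = g x_1^m x_n x_1^(-m) g^(-1) converge
  uniformly, for fixed m and n to infinity, to a null-homotopic loop, so in a metrizable quotient
  one could choose n(m) such that the classes of w(m,n(m)) converge to the identity.
  This is impossible, since these classes form a closed set missing the identity when m is large:
  composing the retraction with the projections to the first and to the n-th circle gives
  u, v : Y -> S^1 with u = 1 or v = 1 everywhere. Lift u along a loop to an angle and record v only
  while this angle equals 2 pi m. The winding number of the recorded function is a homotopy
  invariant. It is 1 for w(m,n), but 0 for any loop whose angle never reaches 2 pi m, and the loops
  uniformly close to a given one have a common bound on their angles.
\<close>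

subsection \<open>Lifts through the exponential and the winding number at a level\<close>

text \<open>The difference of two lifts takes values in the periods of \<open>exp\<close>, which lie
  2 pi apart, so on a connected set it is constant.\<close>

lemma exp_lift_unique:
  fixes f g :: "'b::topological_space \<Rightarrow> complex"
  assumes "connected S" "continuous_on S f" "continuous_on S g"
    and eq: "\<And>x. x \<in> S \<Longrightarrow> exp (f x) = exp (g x)"
    and a: "a \<in> S" "f a = g a" and x: "x \<in> S"
  shows "f x = g x"
proof -
  have "(\<lambda>x. f x - g x) constant_on S"
  proof (rule continuous_discrete_range_constant[OF \<open>connected S\<close>])
    show "continuous_on S (\<lambda>x. f x - g x)"
      using assms by (intro continuous_intros) auto
    show "\<exists>e>0. \<forall>y. y \<in> S \<and> f y - g y \<noteq> f x - g x \<longrightarrow> e \<le> norm (f y - g y - (f x - g x))"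
      if "x \<in> S" for x
    proof (intro exI[of _ "2*pi"] conjI allI impI)
      fix y assume y: "y \<in> S \<and> f y - g y \<noteq> f x - g x"
      have "exp (f y - g y) = exp (f x - g x)"
        using eq y that by (simp add: exp_diff)
      then have "\<not> \<bar>Im (f y - g y) - Im (f x - g x)\<bar> < 2*pi"
        using y exp_complex_eqI by blast
      then show "2*pi \<le> norm (f y - g y - (f x - g x))"
        using abs_Im_le_cmod[of "f y - g y - (f x - g x)"] by simp
    qed (use pi_gt_zero in simp)
  qed
  then show ?thesis
    using a x unfolding constant_on_def by (metis eq_iff_diff_eq_0)
qed

text \<open>Distinct values of \<Theta> at which \<open>exp\<close> is 1 lie at least 2 pi apart. So
  when \<Theta> is close to \<open>c\<close> without being equal to it, \<open>V\<close> is already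
  1 and switching it off causes no jump.\<close>

lemma continuous_on_lamp:
  fixes \<Theta> V :: "'b::topological_space \<Rightarrow> complex"
  assumes \<Theta>: "continuous_on S \<Theta>" and V: "continuous_on S V"
    and uv: "\<And>x. x \<in> S \<Longrightarrow> exp (\<Theta> x) = 1 \<or> V x = 1" and c: "exp c = 1"
  shows "continuous_on S (\<lambda>x. if \<Theta> x = c then V x else 1)"
proof -
  have near: "V x = 1" if "x \<in> S" "\<Theta> x \<noteq> c" "norm (\<Theta> x - c) \<le> 1" for x
  proof -
    have "\<bar>Im (\<Theta> x) - Im c\<bar> < 2*pi"
      using abs_Im_le_cmod[of "\<Theta> x - c"] that(3) pi_gt3 by simp
    then have "exp (\<Theta> x) \<noteq> 1"
      using exp_complex_eqI[of "\<Theta> x" c] c that(2) by auto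
    then show ?thesis
      using uv that(1) by blast
  qed
  \<comment> \<open>The closed disc of radius 1 around \<open>c\<close> replaces the test for
    equality: by \<open>near\<close> both tests define the same function, and \<open>V\<close> is 1
    on the boundary where the pieces are glued.\<close>
  have "continuous_on S (\<lambda>x. if norm (\<Theta> x - c) \<le> 1 then V x else 1)"
  proof (rule continuous_on_cases_le)
    show "continuous_on {x \<in> S. norm (\<Theta> x - c) \<le> 1} V"
      by (rule continuous_on_subset[OF V]) auto
    show "continuous_on S (\<lambda>x. norm (\<Theta> x - c))"
      by (intro continuous_intros \<Theta>)
    show "V x = 1" if "x \<in> S" "norm (\<Theta> x - c) = 1" for x
      using near that by force
  qed auto
  then show ?thesis
    by (rule continuous_on_eq) (use near in auto)
qed

text \<open>The first coordinate is the homotopy parameter. Over the whole square \<open>u\<close>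
  has a lift, and the function recording \<open>v\<close> at level \<open>c\<close> has a logarithm
  \<Lambda>. This is constant on the sides \<open>t = 0\<close> and \<open>t = 1\<close>, where
  nothing moves, and on the row \<open>s = 1\<close>, where the level is never met; so it takes
  equal values at the two ends of the row \<open>s = 0\<close>.\<close>

lemma lamp_degree_homotopy_invariant:
  fixes u v :: "real \<times> real \<Rightarrow> complex" and \<theta>0 \<theta>1 \<phi> :: "real \<Rightarrow> complex"
  assumes u: "continuous_on ({0..1} \<times> {0..1}) u" and v: "continuous_on ({0..1} \<times> {0..1}) v"
    and nz: "\<And>x. x \<in> {0..1} \<times> {0..1} \<Longrightarrow> u x \<noteq> 0 \<and> v x \<noteq> 0 \<and> (u x = 1 \<or> v x = 1)"
    and ends: "\<And>s. s \<in> {0..1} \<Longrightarrow> u (s,0) = u (0,0) \<and> u (s,1) = u (0,1)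
                 \<and> v (s,0) = v (0,0) \<and> v (s,1) = v (0,1)"
    and \<theta>0: "continuous_on {0..1} \<theta>0" "\<And>t. t \<in> {0..1} \<Longrightarrow> exp (\<theta>0 t) = u (0,t)"
    and \<theta>1: "continuous_on {0..1} \<theta>1" "\<And>t. t \<in> {0..1} \<Longrightarrow> exp (\<theta>1 t) = u (1,t)"
    and start: "\<theta>1 0 = \<theta>0 0" and c: "exp c = 1"
    and away: "\<And>t. t \<in> {0..1} \<Longrightarrow> \<theta>1 t \<noteq> c"
    and \<phi>: "continuous_on {0..1} \<phi>"
       "\<And>t. t \<in> {0..1} \<Longrightarrow> exp (\<phi> t) = (if \<theta>0 t = c then v (0,t) else 1)"
  shows "\<phi> 1 = \<phi> 0"
proof -
  let ?I = "{0..1::real}" and ?D = "{0..1} \<times> {0..1::real} :: (real \<times> real) set"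
  have D: "contractible ?D"
    by (intro convex_imp_contractible convex_Times) auto
  have const: "f s = f 0" if "continuous_on ?I f" "\<And>s. s \<in> ?I \<Longrightarrow> exp (f s) = exp (f 0)" "s \<in> ?I"
    for f :: "real \<Rightarrow> complex" and s
    by (rule exp_lift_unique[where S="?I" and g="\<lambda>_. f 0" and a=0])
       (fact that connected_Icc continuous_on_const refl | simp)+
  have row: "continuous_on ?I (\<lambda>t. f (s,t))" "continuous_on ?I (\<lambda>s. f (s,t))"
    if "continuous_on ?D f" "s \<in> ?I" "t \<in> ?I" for f :: "real \<times> real \<Rightarrow> complex" and s t
    using that(2,3) by (auto intro!: continuous_on_compose2[OF that(1)] continuous_intros)
  obtain T where T: "continuous_on ?D T" "\<And>x. x \<in> ?D \<Longrightarrow> u x = exp (T x)"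
    using continuous_logarithm_on_contractible[OF u D] nz by metis
  \<comment> \<open>Both \<open>T\<close> and \<open>\<theta>0\<close> lift \<open>u\<close> at the
    corner, so the shift is a period of \<open>exp\<close> and makes the lift start where
    \<open>\<theta>0\<close> does.\<close>
  define \<Theta> where "\<Theta> x = T x + (\<theta>0 0 - T (0,0))" for x
  have \<Theta>c: "continuous_on ?D \<Theta>"
    unfolding \<Theta>_def by (intro continuous_intros T)
  have "exp (\<theta>0 0 - T (0,0)) = 1"
    using \<theta>0(2)[of 0] T(2)[of "(0,0)"] by (simp add: exp_diff)
  then have \<Theta>e: "exp (\<Theta> x) = u x" if "x \<in> ?D" for x
    using T(2) that by (simp add: \<Theta>_def exp_add)
  have \<Theta>0: "\<Theta> (0,t) = \<theta>0 t" if "t \<in> ?I" for t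
    by (rule exp_lift_unique[of ?I _ _ 0]) (use that \<Theta>e \<theta>0 row[OF \<Theta>c] in \<open>auto simp: \<Theta>_def\<close>)
  have \<Theta>l: "\<Theta> (s,0) = \<Theta> (0,0)" if "s \<in> ?I" for s
  proof (rule const[of "\<lambda>s. \<Theta> (s,0)", OF _ _ that])
    show "exp (\<Theta> (s,0)) = exp (\<Theta> (0,0))" if "s \<in> ?I" for s
      using \<Theta>e[of "(s,0)"] \<Theta>e[of "(0,0)"] ends[OF that] that by simp
  qed (use row(2)[OF \<Theta>c, of 0 0] in auto)
  have \<Theta>r: "\<Theta> (s,1) = \<Theta> (0,1)" if "s \<in> ?I" for s
  proof (rule const[of "\<lambda>s. \<Theta> (s,1)", OF _ _ that])
    show "exp (\<Theta> (s,1)) = exp (\<Theta> (0,1))" if "s \<in> ?I" for s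
      using \<Theta>e[of "(s,1)"] \<Theta>e[of "(0,1)"] ends[OF that] that by simp
  qed (use row(2)[OF \<Theta>c, of 0 1] in auto)
  \<comment> \<open>Agreement at \<open>t = 0\<close> comes from the row \<open>s = 0\<close>,
    carried along the constant side \<open>\<Theta>l\<close> and matched by
    \<open>start\<close>.\<close>
  have \<Theta>1: "\<Theta> (1,t) = \<theta>1 t" if "t \<in> ?I" for t
    by (rule exp_lift_unique[of ?I _ _ 0])
       (use that \<Theta>e[of "(1,_)"] \<theta>1 row(1)[OF \<Theta>c, of 1 0] \<Theta>l[of 1] \<Theta>0[of 0] start in auto)
  define L where "L x = (if \<Theta> x = c then v x else 1)" for x
  have Lc: "continuous_on ?D L"
    unfolding L_def by (rule continuous_on_lamp[OF \<Theta>c v _ c]) (use nz \<Theta>e in auto)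
  obtain \<Lambda> where \<Lambda>: "continuous_on ?D \<Lambda>" "\<And>x. x \<in> ?D \<Longrightarrow> L x = exp (\<Lambda> x)"
    using continuous_logarithm_on_contractible[OF Lc D] nz unfolding L_def
    by (metis (full_types) zero_neq_one)
  have \<Lambda>l: "\<Lambda> (1,0) = \<Lambda> (0,0)"
  proof (rule const[of "\<lambda>s. \<Lambda> (s,0)"])
    show "exp (\<Lambda> (s,0)) = exp (\<Lambda> (0,0))" if "s \<in> ?I" for s
      using \<Lambda>(2)[of "(s,0)"] \<Lambda>(2)[of "(0,0)"] \<Theta>l[OF that] ends[OF that] that
      by (auto simp: L_def split: if_splits)
  qed (use row(2)[OF \<Lambda>(1), of 0 0] in auto)
  have \<Lambda>r: "\<Lambda> (1,1) = \<Lambda> (0,1)"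
  proof (rule const[of "\<lambda>s. \<Lambda> (s,1)"])
    show "exp (\<Lambda> (s,1)) = exp (\<Lambda> (0,1))" if "s \<in> ?I" for s
      using \<Lambda>(2)[of "(s,1)"] \<Lambda>(2)[of "(0,1)"] \<Theta>r[OF that] ends[OF that] that
      by (auto simp: L_def split: if_splits)
  qed (use row(2)[OF \<Lambda>(1), of 0 1] in auto)
  have L1: "exp (\<Lambda> (1,t)) = 1" if "t \<in> ?I" for t
    using \<Lambda>(2)[of "(1,t)"] away[OF that] \<Theta>1[OF that] that
      by (auto simp: L_def split: if_splits)
  have \<Lambda>t: "\<Lambda> (1,1) = \<Lambda> (1,0)"
    by (rule const[of "\<lambda>t. \<Lambda> (1,t)"]) (use row(1)[OF \<Lambda>(1), of 1 0] L1 in auto)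
  have L0: "exp (\<Lambda> (0,t)) = exp (\<phi> t)" if "t \<in> ?I" for t
    using \<Lambda>(2)[of "(0,t)"] \<phi>(2)[OF that] \<Theta>0[OF that] that
      by (auto simp: L_def split: if_splits)
  \<comment> \<open>Both are logarithms of the function recorded on the row \<open>s = 0\<close>, so
    they differ by a constant.\<close>
  have "\<Lambda> (0,1) - \<phi> 1 = \<Lambda> (0,0) - \<phi> 0"
  proof (rule const[of "\<lambda>t. \<Lambda> (0,t) - \<phi> t"])
    show "continuous_on ?I (\<lambda>t. \<Lambda> (0,t) - \<phi> t)"
      using row(1)[OF \<Lambda>(1), of 0 0] \<phi>(1) by (intro continuous_intros) auto
    show "exp (\<Lambda> (0,t) - \<phi> t) = exp (\<Lambda> (0,0) - \<phi> 0)" if "t \<in> ?I" for t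
      using L0[OF that] L0[of 0] by (simp add: exp_diff)
  qed auto
  then show ?thesis
    using \<Lambda>l \<Lambda>r \<Lambda>t by simp
qed

subsection \<open>Paths in the loop space\<close>

text \<open>\<open>U\<close> need not be uniformly continuous on \<open>Y\<close>, but the image of
  \<open>g\<close> is compact: a Lebesgue number of its cover by preimages of balls of radius
  \<open>e/2\<close> serves as \<open>d\<close>.\<close>

lemma uniform_neighbourhood_of_path:
  fixes U :: "'a \<Rightarrow> 'b::metric_space"
  assumes g: "pathin (mtopology_of Y) g" and U: "continuous_map (mtopology_of Y) euclidean U"
    and e: "e > 0"
  obtains d where "d > 0"
    "\<And>t y. \<lbrakk>t \<in> {0..1}; y \<in> mspace Y; mdist Y (g t) y < d\<rbrakk> \<Longrightarrow> dist (U (g t)) (U y) < e"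
proof -
  interpret M: Metric_space "mspace Y" "mdist Y"
    by (rule Metric_space_mspace_mdist)
  have g_in: "g t \<in> mspace Y" if "t \<in> {0..1}" for t
    using path_image_subset_topspace[OF g] that by auto
  let ?C = "(\<lambda>c. {y \<in> mspace Y. U y \<in> ball c (e/2)}) ` UNIV"
  have "\<exists>d>0. \<forall>x \<in> g ` {0..1}. \<exists>W \<in> ?C. M.mball x d \<subseteq> W"
  proof (rule M.lebesgue_number)
    show "compactin M.mtopology (g ` {0..1})"
      using compactin_path_image[OF g] by (simp add: mtopology_of_def)
    show "g ` {0..1} \<subseteq> \<Union>?C"
    proof clarify
      fix t :: real assume "t \<in> {0..1}"
      then have "g t \<in> {y \<in> mspace Y. U y \<in> ball (U (g t)) (e/2)}"
        using g_in e by auto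
      then show "g t \<in> \<Union>?C"
        by blast
    qed
    show "openin M.mtopology W" if "W \<in> ?C" for W
      using that openin_continuous_map_preimage[OF U, of "ball _ (e/2)"]
      by (auto simp: mtopology_of_def)
  qed
  then obtain d where d: "d > 0" "\<And>t. t \<in> {0..1} \<Longrightarrow> \<exists>W \<in> ?C. M.mball (g t) d \<subseteq> W"
    by auto
  show thesis
  proof (rule that[OF d(1)])
    fix t y assume t: "t \<in> {0..1}" and y: "y \<in> mspace Y" "mdist Y (g t) y < d"
    obtain c where c: "M.mball (g t) d \<subseteq> {y \<in> mspace Y. U y \<in> ball c (e/2)}"
      using d(2)[OF t] by blast
    have "y \<in> M.mball (g t) d" "g t \<in> M.mball (g t) d"
      using y g_in[OF t] d(1) by auto
    then have "U y \<in> ball c (e/2)" "U (g t) \<in> ball c (e/2)"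
      using c by auto
    then show "dist (U (g t)) (U y) < e"
      using dist_triangle3[of "U (g t)" "U y" c] by simp
  qed
qed

lemma pathin_uniformly_continuous:
  assumes "pathin (mtopology_of Y) g" "e > 0"
  obtains d where "d > 0"
    "\<And>s t. \<lbrakk>s \<in> {0..1}; t \<in> {0..1}; \<bar>s - t\<bar> < d\<rbrakk> \<Longrightarrow> mdist Y (g s) (g t) < e"
proof -
  have "uniformly_continuous_map (submetric euclidean_metric {0..1}) Y g"
    using assms(1)
    by (intro continuous_imp_uniformly_continuous_map)
       (auto simp: mtopology_of_submetric pathin_def compact_space_subtopology)
  with assms(2) show thesis
    using that by (fastforce simp: uniformly_continuous_map_def dist_real_def)
qed

lemma loops_at_D:
  assumes "f \<in> loops_at Y p"
  shows "pathin (mtopology_of Y) f" "f 0 = p" "f 1 = p" "t \<in> {0..1} \<Longrightarrow> f t \<in> mspace Y"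
  using assms path_image_subset_topspace[of "mtopology_of Y" f] by (auto simp: loops_at_def)

text \<open>A bound \<open>r < d\<close> expresses that the supremum distance is below
  \<open>d\<close> and leaves the margin \<open>d - r\<close>, half of which is the radius allowed
  around \<open>f\<close>.\<close>

lemma openin_loop_space_ball:
  assumes g: "g \<in> loops_at Y p"
  shows "openin (loop_space Y p) {f \<in> loops_at Y p. \<exists>r<d. \<forall>t\<in>{0..1}. mdist Y (g t) (f t) \<le> r}"
  unfolding openin_loop_space uniform_open_def
proof (intro conjI ballI)
  interpret M: Metric_space "mspace Y" "mdist Y"
    by (rule Metric_space_mspace_mdist)
  fix f assume "f \<in> {f \<in> loops_at Y p. \<exists>r<d. \<forall>t\<in>{0..1}. mdist Y (g t) (f t) \<le> r}"
  then obtain r where f: "f \<in> loops_at Y p" and r: "r < d" "\<forall>t\<in>{0..1}. mdist Y (g t) (f t) \<le> r"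
    by auto
  have "\<exists>r<d. \<forall>t\<in>{0..1}. mdist Y (g t) (h t) \<le> r"
    if h: "h \<in> loops_at Y p" "\<forall>t\<in>{0..1}. mdist Y (f t) (h t) < (d - r) / 2" for h
  proof (intro exI[of _ "(d + r) / 2"] conjI ballI)
    fix t :: real assume t: "t \<in> {0..1}"
    then have "mdist Y (g t) (h t) \<le> mdist Y (g t) (f t) + mdist Y (f t) (h t)"
      using loops_at_D(4)[OF g] loops_at_D(4)[OF f] loops_at_D(4)[OF h(1)] by (intro M.triangle)
    also have "\<dots> \<le> r + (d - r) / 2"
      using r(2) h(2) t by (intro add_mono) (auto intro: less_imp_le)
    finally show "mdist Y (g t) (h t) \<le> (d + r) / 2"
      by (simp add: field_simps)
  qed (use r in simp)
  then show "\<exists>e>0. \<forall>h\<in>loops_at Y p. (\<forall>t\<in>{0..1}. mdist Y (f t) (h t) < e) \<longrightarrow>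
      h \<in> {f \<in> loops_at Y p. \<exists>r<d. \<forall>t\<in>{0..1}. mdist Y (g t) (f t) \<le> r}"
    using r(1) by (intro exI[of _ "(d - r) / 2"]) auto
qed auto

text \<open>Turns a path of loops into a homotopy on the square. Passing from \<open>(s',t')\<close>
  to \<open>(s,t')\<close> is controlled uniformly in \<open>t'\<close> by the topology of the loop
  space; the rest of the way runs along the fixed loop \<open>\<phi> s\<close>.\<close>

lemma continuous_on_pathin_loop_space:
  fixes U :: "'a \<Rightarrow> 'b::metric_space"
  assumes \<phi>: "pathin (loop_space Y p) \<phi>" and U: "continuous_map (mtopology_of Y) euclidean U"
  shows "continuous_on ({0..1} \<times> {0..1}) (\<lambda>x. U (\<phi> (fst x) (snd x)))"
  unfolding continuous_on_iff
proof (intro ballI allI impI)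
  interpret M: Metric_space "mspace Y" "mdist Y"
    by (rule Metric_space_mspace_mdist)
  fix x :: "real \<times> real" and e :: real
  assume x: "x \<in> {0..1} \<times> {0..1}" and e: "e > 0"
  obtain s t where st: "x = (s,t)" "s \<in> {0..1}" "t \<in> {0..1}"
    using x by auto
  have \<phi>_in: "\<phi> s' \<in> loops_at Y p" if "s' \<in> {0..1}" for s'
    using path_image_subset_topspace[OF \<phi>] that by auto
  note g = \<phi>_in[OF st(2)]
  obtain d where d: "d > 0"
    "\<And>t y. \<lbrakk>t \<in> {0..1}; y \<in> mspace Y; mdist Y (\<phi> s t) y < d\<rbrakk> \<Longrightarrow> dist (U (\<phi> s t)) (U y) < e/2"
    using uniform_neighbourhood_of_path[OF loops_at_D(1)[OF g] U, of "e/2"] e by auto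
  let ?B = "{f \<in> loops_at Y p. \<exists>r<d. \<forall>t\<in>{0..1}. mdist Y (\<phi> s t) (f t) \<le> r}"
  have "\<phi> s \<in> ?B"
    using g d(1) loops_at_D(4)[OF g] by (auto intro!: exI[of _ 0])
  moreover have "openin (top_of_set {0..1}) {s' \<in> {0..1}. \<phi> s' \<in> ?B}"
    using openin_continuous_map_preimage[OF \<phi>[unfolded pathin_def] openin_loop_space_ball[OF g, of d]]
    by simp
  ultimately obtain a where a: "a > 0" "\<And>s'. \<lbrakk>s' \<in> {0..1}; dist s' s < a\<rbrakk> \<Longrightarrow> \<phi> s' \<in> ?B"
    unfolding openin_euclidean_subtopology_iff using st(2) by (smt (verit) mem_Collect_eq)
  have "continuous_on {0..1} (\<lambda>t. U (\<phi> s t))"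
    using continuous_map_compose[OF loops_at_D(1)[OF g, unfolded pathin_def] U]
    by (simp add: o_def)
  then obtain b where b: "b > 0"
    "\<And>t'. \<lbrakk>t' \<in> {0..1}; dist t' t < b\<rbrakk> \<Longrightarrow> dist (U (\<phi> s t')) (U (\<phi> s t)) < e/2"
    using st(3) half_gt_zero[OF e] unfolding continuous_on_iff by metis
  show "\<exists>c>0. \<forall>x'\<in>{0..1} \<times> {0..1}. dist x' x < c \<longrightarrow>
      dist (U (\<phi> (fst x') (snd x'))) (U (\<phi> (fst x) (snd x))) < e"
  proof (intro exI[of _ "min a b"] conjI ballI impI)
    fix x' :: "real \<times> real" assume x': "x' \<in> {0..1} \<times> {0..1}" and dx: "dist x' x < min a b"
    obtain s' t' where st': "x' = (s',t')" "s' \<in> {0..1}" "t' \<in> {0..1}"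
      using x' by auto
    have ds: "dist s' s < a" and dt: "dist t' t < b"
      using dx dist_fst_le[of x' x] dist_snd_le[of x' x] st st' by auto
    have "mdist Y (\<phi> s t') (\<phi> s' t') < d"
      using a(2)[OF st'(2) ds] st'(3) by fastforce
    then have "dist (U (\<phi> s t')) (U (\<phi> s' t')) < e/2"
      using d(2) st' loops_at_D(4)[OF \<phi>_in[OF st'(2)]] by auto
    then show "dist (U (\<phi> (fst x') (snd x'))) (U (\<phi> (fst x) (snd x))) < e"
      using b(2)[OF st'(3) dt] dist_triangle_half_r[of "U (\<phi> s t')" "U (\<phi> s' t')" e "U (\<phi> s t)"]
      by (simp add: st st')
  qed (use a b in simp)
qed

lemma pathin_loop_spaceI:
  assumes \<phi>: "\<And>s. s \<in> {0..1} \<Longrightarrow> \<phi> s \<in> loops_at Y p"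
    and unif: "\<And>e. e > 0 \<Longrightarrow> \<exists>d>0. \<forall>s\<in>{0..1}. \<forall>s'\<in>{0..1}. \<bar>s - s'\<bar> < d \<longrightarrow>
                 (\<forall>t\<in>{0..1}. mdist Y (\<phi> s t) (\<phi> s' t) < e)"
  shows "pathin (loop_space Y p) \<phi>"
  unfolding pathin_def continuous_map
proof (intro conjI allI impI)
  show "\<phi> ` topspace (top_of_set {0..1}) \<subseteq> topspace (loop_space Y p)"
    using \<phi> by auto
  fix W assume "openin (loop_space Y p) W"
  then have W: "\<forall>f\<in>W. \<exists>e>0. \<forall>g\<in>loops_at Y p. (\<forall>t\<in>{0..1}. mdist Y (f t) (g t) < e) \<longrightarrow> g \<in> W"
    unfolding openin_loop_space uniform_open_def by blast
  show "openin (top_of_set {0..1}) {s \<in> topspace (top_of_set {0..1}). \<phi> s \<in> W}"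
    unfolding openin_euclidean_subtopology_iff
  proof (intro conjI ballI)
    fix s assume "s \<in> {s \<in> topspace (top_of_set {0..1}). \<phi> s \<in> W}"
    then have s: "s \<in> {0..1}" "\<phi> s \<in> W"
      by auto
    then obtain e where e: "e > 0"
      "\<And>g. \<lbrakk>g \<in> loops_at Y p; \<forall>t\<in>{0..1}. mdist Y (\<phi> s t) (g t) < e\<rbrakk> \<Longrightarrow> g \<in> W"
      using W by blast
    obtain d where "d > 0" "\<And>s'. \<lbrakk>s' \<in> {0..1}; \<bar>s - s'\<bar> < d\<rbrakk> \<Longrightarrow>
        \<forall>t\<in>{0..1}. mdist Y (\<phi> s t) (\<phi> s' t) < e"
      using unif[OF e(1)] s(1) by blast
    then show "\<exists>d>0. \<forall>s'\<in>{0..1}. dist s' s < d \<longrightarrow> s' \<in> {s \<in> topspace (top_of_set {0..1}). \<phi> s \<in> W}"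
      using e(2) \<phi> by (auto simp: dist_real_def abs_minus_commute intro!: exI[of _ d])
  qed auto
qed

section \<open>Conjugate loops\<close>

lemma continuous_map_pathin_compose:
  assumes "pathin X d" "continuous_on S h" "h ` S \<subseteq> {0..1}"
  shows "continuous_map (top_of_set S) X (\<lambda>t. d (h t))"
  using continuous_map_compose[of "top_of_set S" "top_of_set {0..1}" h X d] assms
  by (auto simp: pathin_def o_def continuous_map_in_subtopology)

text \<open>The conjugate of \<open>c\<close> by \<open>d\<close>, one third of the interval for
  each piece. The restriction supplies the value \<open>undefined\<close> outside the interval that
  \<open>loops_at\<close> demands.\<close>

definition lollipop :: "(real \<Rightarrow> 'b) \<Rightarrow> (real \<Rightarrow> 'b) \<Rightarrow> real \<Rightarrow> 'b" where
  "lollipop d c = (\<lambda>t\<in>{0..1}. if t \<le> 1/3 then d (3 * t) else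
                              if t \<le> 2/3 then c (3 * t - 1) else d (3 - 3 * t))"

lemma pathin_lollipop:
  assumes d: "pathin X d" and c: "pathin X c" and "c 0 = d 1" "c 1 = d 1"
  shows "pathin X (lollipop d c)"
proof -
  have corner1: "d (3 * t) = c (3 * t - 1)" if "t * 3 = 1" for t
  proof -
    have "3 * t = 1" "3 * t - 1 = 0"
      using that by simp_all
    then show ?thesis
      by (simp only: assms)
  qed
  have corner2: "c (3 * t - 1) = d (3 - 3 * t)" if "t * 3 = 2" for t
  proof -
    have "3 * t - 1 = 1" "3 - 3 * t = 1"
      using that by simp_all
    then show ?thesis
      by (simp only: assms)
  qed
  have "continuous_map (top_of_set {0..1}) X
     (\<lambda>t. if t \<le> 1/3 then d (3 * t) else if t \<le> 2/3 then c (3 * t - 1) else d (3 - 3 * t))"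
  proof (rule continuous_map_cases_le)
    show "continuous_map (subtopology (top_of_set {0..1}) {t \<in> topspace (top_of_set {0..1}). t \<le> 1/3}) X
            (\<lambda>t. d (3 * t))"
      unfolding subtopology_subtopology
      by (intro continuous_map_pathin_compose[OF d] continuous_intros) auto
    show "continuous_map (subtopology (top_of_set {0..1}) {t \<in> topspace (top_of_set {0..1}). 1/3 \<le> t}) X
            (\<lambda>t. if t \<le> 2/3 then c (3 * t - 1) else d (3 - 3 * t))"
      unfolding subtopology_subtopology
      by (intro continuous_map_cases_le; (unfold subtopology_subtopology)?;
          (intro continuous_map_pathin_compose[OF d] continuous_map_pathin_compose[OF c] continuous_intros)?)
         (use corner2 in \<open>auto simp: image_subset_iff\<close>)
  qed (use corner1 in \<open>auto intro: continuous_intros\<close>)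
  then show ?thesis
    unfolding pathin_def lollipop_def by (rule continuous_map_eq) auto
qed

subsection \<open>Retracting onto a sequence of shrinking circles\<close>

text \<open>What a retraction onto the earring provides: \<gamma> leads to the wedge point, \<alpha>
  winds along the first circle, \<open>\<beta> n\<close> runs once round a small circle, and
  \<open>u\<close> and \<open>v n\<close> are the projections to these circles. \<alpha> lives on
  the whole line so that its restriction to [0, m] makes \<open>m\<close> turns.\<close>

locale lamp_family =
  fixes Y :: "'a metric" and y0 :: 'a and \<gamma> \<alpha> :: "real \<Rightarrow> 'a" and \<beta> :: "nat \<Rightarrow> real \<Rightarrow> 'a"
    and u :: "'a \<Rightarrow> complex" and v :: "nat \<Rightarrow> 'a \<Rightarrow> complex"
  assumes u_cont: "continuous_map (mtopology_of Y) euclidean u"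
    and v_cont: "continuous_map (mtopology_of Y) euclidean (v n)"
    and norm_u: "y \<in> mspace Y \<Longrightarrow> norm (u y) = 1"
    and norm_v: "y \<in> mspace Y \<Longrightarrow> norm (v n y) = 1"
    and uv: "y \<in> mspace Y \<Longrightarrow> u y = 1 \<or> v n y = 1"
    and \<gamma>: "pathin (mtopology_of Y) \<gamma>" "\<gamma> 0 = y0"
    and \<alpha>: "continuous_map euclideanreal (mtopology_of Y) \<alpha>"
    and u_\<alpha>: "u (\<alpha> x) = exp (complex_of_real (2 * pi * x) * \<i>)"
    and v_\<alpha>: "v n (\<alpha> x) = 1"
    and \<alpha>_nat: "\<alpha> (real m) = \<gamma> 1"
    and \<beta>: "pathin (mtopology_of Y) (\<beta> n)" "\<beta> n 0 = \<gamma> 1" "\<beta> n 1 = \<gamma> 1"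
    and u_\<beta>: "u (\<beta> n x) = 1"
    and v_\<beta>: "v n (\<beta> n x) = exp (complex_of_real (2 * pi * x) * \<i>)"
    and \<beta>_small: "e > 0 \<Longrightarrow> \<forall>\<^sub>F n in sequentially. \<forall>t\<in>{0..1}. mdist Y (\<gamma> 1) (\<beta> n t) < e"
begin

text \<open>After \<gamma> come \<open>m\<close> turns along \<alpha>, which raise the angle of
  \<open>u\<close> at the wedge point by \<open>2 pi m\<close>.\<close>

definition stem :: "nat \<Rightarrow> real \<Rightarrow> 'a" where
  "stem m t = (if t \<le> 1/2 then \<gamma> (2 * t) else \<alpha> (real m * (2 * t - 1)))"

definition probe :: "nat \<Rightarrow> nat \<Rightarrow> real \<Rightarrow> 'a" where
  "probe m n = lollipop (stem m) (\<beta> n)"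

text \<open>The position on the stem at time \<open>t\<close> of a probe: out, waiting at 1 during
  the middle third, and back.\<close>

definition tent :: "real \<Rightarrow> real" where
  "tent t = min 1 (min (3 * t) (3 - 3 * t))"

text \<open>Giving the wedge point angle 0 puts the end of \<open>stem m\<close> exactly at level
  \<open>2 pi m\<close>. The start value then normalizes the lifts of all loops at \<open>y0\<close>
  alike, whatever \<open>m\<close> is.\<close>

definition base_lift :: "real \<Rightarrow> complex" where
  "base_lift = (SOME \<theta>. continuous_on {0..1} \<theta> \<and> (\<forall>t\<in>{0..1}. exp (\<theta> t) = u (\<gamma> t)) \<and> \<theta> 1 = 0)"

lemma stem_0: "stem m 0 = y0" and stem_1: "stem m 1 = \<gamma> 1"
  by (simp_all add: stem_def \<gamma> \<alpha>_nat)

lemma pathin_stem: "pathin (mtopology_of Y) (stem m)"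
proof -
  have "continuous_map (top_of_set {0..1}) (mtopology_of Y)
    (\<lambda>t. if t \<le> 1/2 then \<gamma> (2 * t) else \<alpha> (real m * (2 * t - 1)))"
  proof (rule continuous_map_cases_le)
    show "continuous_map (subtopology (top_of_set {0..1}) {t \<in> topspace (top_of_set {0..1}). t \<le> 1/2})
            (mtopology_of Y) (\<lambda>t. \<gamma> (2 * t))"
      unfolding subtopology_subtopology
      by (intro continuous_map_pathin_compose[OF \<gamma>(1)] continuous_intros) auto
    have "continuous_map (top_of_set T) (mtopology_of Y) (\<alpha> \<circ> (\<lambda>t. real m * (2 * t - 1)))" for T
      by (rule continuous_map_compose[OF _ \<alpha>]) (auto intro!: continuous_intros)
    then show "continuous_map (subtopology (top_of_set {0..1}) {t \<in> topspace (top_of_set {0..1}). 1/2 \<le> t})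
            (mtopology_of Y) (\<lambda>t. \<alpha> (real m * (2 * t - 1)))"
      unfolding subtopology_subtopology o_def .
    show "\<gamma> (2 * t) = \<alpha> (real m * (2 * t - 1))" if "t = 1/2" for t
    proof -
      have "2 * t = 1" "real m * (2 * t - 1) = 0"
        using that by simp_all
      then show ?thesis
        using \<alpha>_nat[of 0] by (simp only: of_nat_0)
    qed
  qed (auto intro: continuous_intros)
  then show ?thesis
    by (simp add: pathin_def stem_def[abs_def])
qed

lemma stem_in: "t \<in> {0..1} \<Longrightarrow> stem m t \<in> mspace Y"
  using path_image_subset_topspace[OF pathin_stem, of m] by auto

lemma probe_in_loops: "probe m n \<in> loops_at Y y0"
proof -
  have "pathin (mtopology_of Y) (probe m n)"
    unfolding probe_def by (rule pathin_lollipop) (auto simp: pathin_stem \<beta> stem_1)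
  then show ?thesis
    by (simp add: loops_at_def) (simp add: probe_def lollipop_def stem_0)
qed

lemma continuous_tent: "continuous_on S tent"
  unfolding tent_def by (intro continuous_intros)

lemma tent_in: "t \<in> {0..1} \<Longrightarrow> tent t \<in> {0..1}"
  by (auto simp: tent_def)

lemma base_lift:
  "continuous_on {0..1} base_lift" "t \<in> {0..1} \<Longrightarrow> exp (base_lift t) = u (\<gamma> t)" "base_lift 1 = 0"
proof -
  have c: "continuous_on {0..1} (\<lambda>t. u (\<gamma> t))"
    using continuous_map_compose[OF \<gamma>(1)[unfolded pathin_def] u_cont] by (simp add: o_def)
  have nz: "u (\<gamma> t) \<noteq> 0" if "t \<in> {0..1}" for t
  proof -
    have "\<gamma> t \<in> mspace Y"
      using path_image_subset_topspace[OF \<gamma>(1)] that by (auto simp: Pi_iff)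
    then show ?thesis
      using norm_u by force
  qed
  obtain \<theta> where \<theta>: "continuous_on {0..1} \<theta>" "\<And>t. t \<in> {0..1} \<Longrightarrow> u (\<gamma> t) = exp (\<theta> t)"
    using continuous_logarithm_on_contractible[OF c convex_imp_contractible[OF convex_real_interval(5)] nz] by metis
  \<comment> \<open>The wedge point is \<open>\<alpha> 0\<close>, where \<open>u\<close> is 1, so
    subtracting the end value still leaves a lift.\<close>
  have "exp (\<theta> 1) = 1"
    using \<theta>(2)[of 1] u_\<alpha>[of 0] \<alpha>_nat[of 0] by simp
  then have "continuous_on {0..1} (\<lambda>t. \<theta> t - \<theta> 1) \<and>
     (\<forall>t\<in>{0..1}. exp (\<theta> t - \<theta> 1) = u (\<gamma> t)) \<and> \<theta> 1 - \<theta> 1 = 0"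
    using \<theta> by (auto intro!: continuous_intros simp: exp_diff)
  from someI[of "\<lambda>\<theta>. continuous_on {0..1} \<theta> \<and> (\<forall>t\<in>{0..1}. exp (\<theta> t) = u (\<gamma> t)) \<and> \<theta> 1 = 0", OF this]
  show "continuous_on {0..1} base_lift" "t \<in> {0..1} \<Longrightarrow> exp (base_lift t) = u (\<gamma> t)" "base_lift 1 = 0"
    unfolding base_lift_def by blast+
qed

text \<open>\<open>max 0 (min 1 (3 * t - 1))\<close> is the clamped progress along
  \<open>\<beta> n\<close>; with it and \<open>tent\<close>, a single formula describes a lift on
  all three thirds.\<close>

lemma probe_cases:
  assumes "t \<in> {0..1}"
  obtains "probe m n t = stem m (tent t)" "max 0 (min 1 (3 * t - 1)) = 0"
  | "probe m n t = \<beta> n (3 * t - 1)" "tent t = 1" "max 0 (min 1 (3 * t - 1)) = 3 * t - 1"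
  | "probe m n t = stem m (tent t)" "max 0 (min 1 (3 * t - 1)) = 1"
proof (cases "t \<le> 1/3")
  case True
  then have "tent t = 3 * t"
    by (simp add: tent_def)
  then show ?thesis using assms that(1) True by (simp add: probe_def lollipop_def)
next
  case F: False
  show ?thesis
  proof (cases "t \<le> 2/3")
    case True
    then show ?thesis using assms that(2) F by (simp add: probe_def lollipop_def tent_def)
  next
    case False
    then have "tent t = 3 - 3 * t"
      by (simp add: tent_def)
    then show ?thesis using assms that(3) F False by (simp add: probe_def lollipop_def)
  qed
qed

text \<open>\<open>\<alpha> m\<close> and \<open>\<alpha> 0\<close> are the same point, so
  \<open>u\<close> has the same value at both.\<close>

lemma exp_winding: "exp (complex_of_real (2 * pi * real m) * \<i>) = 1"
  by (metis \<alpha>_nat of_nat_0 u_\<alpha> mult_zero_right of_real_0 mult_zero_left exp_zero)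

text \<open>At level \<open>2 pi m\<close> the probe records the full turn of
  \<open>\<beta> n\<close>; whatever is recorded on the stem is run through forwards and backwards
  and cancels. A loop whose angle avoids the level records nothing, against homotopy
  invariance.\<close>

lemma probe_not_homotopic:
  assumes hom: "path_component_of (loop_space Y y0) (probe m n) g"
    and \<theta>: "continuous_on {0..1} \<theta>" "\<And>t. t \<in> {0..1} \<Longrightarrow> exp (\<theta> t) = u (g t)" "\<theta> 0 = base_lift 0"
    and away: "\<And>t. t \<in> {0..1} \<Longrightarrow> \<theta> t \<noteq> complex_of_real (2 * pi * real m) * \<i>"
  shows False
proof -
  define c where "c = complex_of_real (2 * pi * real m) * \<i>"
  obtain h where h: "pathin (loop_space Y y0) h" "h 0 = probe m n" "h 1 = g"
    using hom unfolding path_component_of_def by blast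
  have h_in: "h s \<in> loops_at Y y0" if "s \<in> {0..1}" for s
    using path_image_subset_topspace[OF h(1)] that by auto
  \<comment> \<open>The clamps freeze the first summand at \<open>base_lift 1 = 0\<close> once
    \<gamma> is finished and keep the second at 0 until then.\<close>
  define \<Theta> where "\<Theta> t = base_lift (min 1 (2 * t)) + complex_of_real (2 * pi * (real m * max 0 (2 * t - 1))) * \<i>" for t
  have \<Theta>c: "continuous_on {0..1} \<Theta>"
    unfolding \<Theta>_def by (intro continuous_intros continuous_on_compose2[OF base_lift(1)]) auto
  have \<Theta>e: "exp (\<Theta> t) = u (stem m t)" if "t \<in> {0..1}" for t
  proof (cases "t \<le> 1/2")
    case True
    then show ?thesis using base_lift(2)[of "2*t"] that by (simp add: \<Theta>_def stem_def)
  next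
    case False
    then have "min 1 (2 * t) = 1" "max 0 (2 * t - 1) = 2 * t - 1"
      by auto
    then show ?thesis using False u_\<alpha> by (simp add: \<Theta>_def stem_def base_lift(3))
  qed
  have \<Theta>1: "\<Theta> 1 = c"
    by (simp add: \<Theta>_def c_def base_lift(3))
  have c1: "exp c = 1"
    unfolding c_def by (rule exp_winding)
  have v_stem: "continuous_on {0..1} (\<lambda>t. v n (stem m t))"
    using continuous_map_compose[OF pathin_stem[unfolded pathin_def] v_cont] by (simp add: o_def)
  \<comment> \<open>Along \<gamma> the angle may already meet \<open>c\<close> while
    \<open>v n\<close> is nontrivial, so the recording on the stem itself has to be
    included.\<close>
  define L where "L t = (if \<Theta> t = c then v n (stem m t) else 1)" for t
  have Lc: "continuous_on {0..1} L"
    unfolding L_def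
    by (rule continuous_on_lamp[OF \<Theta>c v_stem _ c1]) (use \<Theta>e uv stem_in in metis)
  have Lnz: "L t \<noteq> 0" if "t \<in> {0..1}" for t
    using norm_v[OF stem_in[OF that, of m], of n] by (auto simp: L_def)
  obtain \<Lambda> where \<Lambda>: "continuous_on {0..1} \<Lambda>" "\<And>t. t \<in> {0..1} \<Longrightarrow> L t = exp (\<Lambda> t)"
    using continuous_logarithm_on_contractible[OF Lc convex_imp_contractible[OF convex_real_interval(5)] Lnz] by metis
  have "v n (\<gamma> 1) = 1"
    using v_\<alpha>[of n 0] \<alpha>_nat[of 0] by simp
  then have \<Lambda>1: "exp (\<Lambda> 1) = 1"
    using \<Lambda>(2)[of 1] by (simp add: L_def stem_1 split: if_splits)
  \<comment> \<open>Subtracting \<open>\<Lambda> 1\<close>, a period of \<open>exp\<close>, changes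
    no exponential; in the middle third, where \<open>tent t = 1\<close>, only the angle of
    \<open>\<beta> n\<close> remains.\<close>
  define \<phi> where "\<phi> t = \<Lambda> (tent t) - \<Lambda> 1 + complex_of_real (2 * pi * max 0 (min 1 (3 * t - 1))) * \<i>" for t
  have \<Lambda>_tent: "continuous_on {0..1} (\<lambda>t. \<Lambda> (tent t))"
    by (rule continuous_on_compose2[OF \<Lambda>(1) continuous_tent]) (use tent_in in auto)
  have "\<phi> 1 = \<phi> 0"
  proof (rule lamp_degree_homotopy_invariant)
    show "continuous_on ({0..1} \<times> {0..1}) (\<lambda>x. u (h (fst x) (snd x)))"
      by (rule continuous_on_pathin_loop_space[OF h(1) u_cont])
    show "continuous_on ({0..1} \<times> {0..1}) (\<lambda>x. v n (h (fst x) (snd x)))"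
      by (rule continuous_on_pathin_loop_space[OF h(1) v_cont])
    show "u (h (fst x) (snd x)) \<noteq> 0 \<and> v n (h (fst x) (snd x)) \<noteq> 0 \<and>
        (u (h (fst x) (snd x)) = 1 \<or> v n (h (fst x) (snd x)) = 1)" if "x \<in> {0..1} \<times> {0..1}" for x
    proof -
      have "h (fst x) (snd x) \<in> mspace Y"
        using that loops_at_D(4)[OF h_in, of "fst x" "snd x"] by auto
      then show ?thesis
        using norm_u norm_v[of _ n] uv[of _ n] by fastforce
    qed
    show "u (h (fst (s,0)) (snd (s,0))) = u (h (fst (0,0)) (snd (0::real,0))) \<and>
       u (h (fst (s,1)) (snd (s,1))) = u (h (fst (0,1)) (snd (0::real,1))) \<and>
       v n (h (fst (s,0)) (snd (s,0))) = v n (h (fst (0,0)) (snd (0::real,0))) \<and>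
       v n (h (fst (s,1)) (snd (s,1))) = v n (h (fst (0,1)) (snd (0::real,1)))" if "s \<in> {0..1}" for s
      using loops_at_D(2,3)[OF h_in[OF that]] loops_at_D(2,3)[OF h_in[of 0]] by simp
    show "continuous_on {0..1} (\<lambda>t. \<Theta> (tent t))"
      by (rule continuous_on_compose2[OF \<Theta>c continuous_tent]) (use tent_in in auto)
    show "exp (\<Theta> (tent t)) = u (h (fst (0,t)) (snd (0::real,t)))" if "t \<in> {0..1}" for t
      using that
      by (rule probe_cases[of t m n])
         (use \<Theta>e[OF tent_in[OF that]] \<Theta>1 c1 u_\<beta> in \<open>auto simp: h(2)\<close>)
    show "continuous_on {0..1} \<theta>" "\<theta> 0 = \<Theta> (tent 0)" "exp c = 1"
      using \<theta> c1 by (auto simp: \<Theta>_def tent_def)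
    show "exp (\<theta> t) = u (h (fst (1,t)) (snd (1::real,t)))" "\<theta> t \<noteq> c" if "t \<in> {0..1}" for t
      using \<theta>(2)[OF that] away[OF that] by (auto simp: h(3) c_def)
    show "continuous_on {0..1} \<phi>"
      unfolding \<phi>_def
      by (intro continuous_intros \<Lambda>_tent)
    show "exp (\<phi> t) = (if \<Theta> (tent t) = c then v n (h (fst (0,t)) (snd (0::real,t))) else 1)"
      if t: "t \<in> {0..1}" for t
      using t
    proof (rule probe_cases[of t m n])
      assume A: "probe m n t = stem m (tent t)" "max 0 (min 1 (3 * t - 1)) = 0"
      have "exp (\<phi> t) = L (tent t)"
        unfolding \<phi>_def A(2) \<Lambda>(2)[OF tent_in[OF t]] exp_add exp_diff \<Lambda>1 by simp
      then show ?thesis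
        by (simp add: L_def h(2) A(1))
    next
      assume A: "probe m n t = \<beta> n (3 * t - 1)" "tent t = 1" "max 0 (min 1 (3 * t - 1)) = 3 * t - 1"
      show ?thesis
        unfolding \<phi>_def A(2,3) fst_conv snd_conv h(2) A(1) v_\<beta> using \<Theta>1 by simp
    next
      assume A: "probe m n t = stem m (tent t)" "max 0 (min 1 (3 * t - 1)) = 1"
      have "exp (\<phi> t) = L (tent t)"
        unfolding \<phi>_def A(2) \<Lambda>(2)[OF tent_in[OF t]] exp_add exp_diff \<Lambda>1
        using exp_winding[of 1] by simp
      then show ?thesis
        by (simp add: L_def h(2) A(1))
    qed
  qed
  \<comment> \<open>\<open>tent\<close> vanishes at both ends, so \<open>\<phi> 1 - \<phi> 0\<close>
    is 2 pi i.\<close>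
  then show False
    by (simp add: \<phi>_def tent_def)
qed

text \<open>A lift for \<open>g\<close> is bounded by compactness. If \<open>u\<close> along
  \<open>f\<close> stays within 1 of \<open>u\<close> along \<open>g\<close>, their quotient stays
  in the right half plane, so its principal logarithm is a continuous correction of size at most
  pi.\<close>

lemma bounded_lift_near_loop:
  assumes g: "g \<in> loops_at Y y0"
  obtains d N where "d > 0"
    "\<And>f. \<lbrakk>f \<in> loops_at Y y0; \<forall>t\<in>{0..1}. mdist Y (g t) (f t) < d\<rbrakk> \<Longrightarrow>
       \<exists>\<theta>. continuous_on {0..1} \<theta> \<and> (\<forall>t\<in>{0..1}. exp (\<theta> t) = u (f t)) \<and> \<theta> 0 = base_lift 0 \<and>
           (\<forall>t\<in>{0..1}. norm (\<theta> t) \<le> N)"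
proof -
  have uc: "continuous_on {0..1} (\<lambda>t. u (f t))" if "f \<in> loops_at Y y0" for f
    using continuous_map_compose[OF loops_at_D(1)[OF that, unfolded pathin_def] u_cont]
    by (simp add: o_def)
  have un: "norm (u (f t)) = 1" if "f \<in> loops_at Y y0" "t \<in> {0..1}" for f t
    using loops_at_D(4)[OF that] norm_u by blast
  have unz: "u (f t) \<noteq> 0" if "f \<in> loops_at Y y0" "t \<in> {0..1}" for f t
    using un[OF that] by auto
  obtain T where T: "continuous_on {0..1} T" "\<And>t. t \<in> {0..1} \<Longrightarrow> u (g t) = exp (T t)"
    using continuous_logarithm_on_contractible[OF uc[OF g] convex_imp_contractible[OF convex_real_interval(5)] unz[OF g]]
    by metis
  have T0: "exp (base_lift 0 - T 0) = 1"
    using T(2)[of 0] base_lift(2)[of 0] loops_at_D(2)[OF g] by (simp add: exp_diff \<gamma>(2))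
  define G where "G t = T t + (base_lift 0 - T 0)" for t
  have Gc: "continuous_on {0..1} G"
    unfolding G_def by (intro continuous_intros T)
  have Ge: "exp (G t) = u (g t)" if "t \<in> {0..1}" for t
    unfolding G_def exp_add T0 using T(2)[OF that] by simp
  have "bounded (G ` {0..1})"
    by (intro compact_imp_bounded compact_continuous_image Gc) auto
  then obtain B where "\<forall>z \<in> G ` {0..1}. norm z \<le> B"
    unfolding bounded_iff by blast
  then have B: "norm (G t) \<le> B" if "t \<in> {0..1}" for t
    using that by blast
  obtain d where d: "d > 0"
    "\<And>t y. \<lbrakk>t \<in> {0..1}; y \<in> mspace Y; mdist Y (g t) y < d\<rbrakk> \<Longrightarrow> dist (u (g t)) (u y) < 1"
    using uniform_neighbourhood_of_path[OF loops_at_D(1)[OF g] u_cont zero_less_one] by blast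
  show thesis
  proof (rule that[OF d(1)])
    fix f assume f: "f \<in> loops_at Y y0" and fd: "\<forall>t\<in>{0..1}. mdist Y (g t) (f t) < d"
    define q where "q t = u (f t) / u (g t)" for t
    have q: "Re (q t) > 0" "norm (q t) = 1" if "t \<in> {0..1}" for t
    proof -
      have "norm (u (g t) - u (f t)) < 1"
        using d(2)[OF that loops_at_D(4)[OF f that]] fd that by (simp add: dist_norm)
      \<comment> \<open>Since \<open>u (g t)\<close> has modulus 1, factoring it out leaves
        \<open>norm (1 - q t) < 1\<close>, which forces a positive real part.\<close>
      also have "u (g t) - u (f t) = u (g t) * (1 - q t)"
        using unz[OF g that] by (simp add: q_def field_simps)
      finally have "norm (1 - q t) < 1"
        using un[OF g that] by (simp add: norm_mult)
      then show "Re (q t) > 0"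
        using abs_Re_le_cmod[of "1 - q t"] by simp
      show "norm (q t) = 1"
        using un[OF g that] un[OF f that] by (simp add: q_def norm_divide)
    qed
    have "continuous_on {0..1} q"
      unfolding q_def using uc f g unz by (intro continuous_intros) auto
    then have Lnc: "continuous_on {0..1} (\<lambda>t. Ln (q t))"
      by (rule continuous_on_Ln') (use q(1) in \<open>force simp: complex_nonpos_Reals_iff\<close>)
    have Ln_le: "norm (Ln (q t)) \<le> pi" if "t \<in> {0..1}" for t
    proof -
      have nz: "q t \<noteq> 0"
        using q(2)[OF that] by auto
      then have "Re (Ln (q t)) = 0"
        using q(2)[OF that] by simp
      then show ?thesis
        using cmod_le[of "Ln (q t)"] Im_Ln_le_pi[OF nz] mpi_less_Im_Ln[OF nz] by linarith
    qed
    show "\<exists>\<theta>. continuous_on {0..1} \<theta> \<and> (\<forall>t\<in>{0..1}. exp (\<theta> t) = u (f t)) \<and> \<theta> 0 = base_lift 0 \<and>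
           (\<forall>t\<in>{0..1}. norm (\<theta> t) \<le> B + pi)"
    proof (intro exI[of _ "\<lambda>t. G t + Ln (q t)"] conjI ballI)
      show "continuous_on {0..1} (\<lambda>t. G t + Ln (q t))"
        by (intro continuous_intros Gc Lnc)
      show "exp (G t + Ln (q t)) = u (f t)" if "t \<in> {0..1}" for t
      proof -
        have "q t \<noteq> 0"
          using q(2)[OF that] by auto
        then show ?thesis
          using unz[OF g that] Ge[OF that] by (simp add: exp_add q_def)
      qed
      \<comment> \<open>Both loops start at \<open>y0\<close>, so \<open>q 0 = 1\<close> and the
        correction vanishes there.\<close>
      show "G 0 + Ln (q 0) = base_lift 0"
        using loops_at_D(2)[OF f] loops_at_D(2)[OF g] unz[OF g, of 0] by (simp add: G_def q_def)
      show "norm (G t + Ln (q t)) \<le> B + pi" if "t \<in> {0..1}" for t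
        using norm_triangle_ineq[of "G t" "Ln (q t)"] B[OF that] Ln_le[OF that] by linarith
    qed
  qed
qed

section \<open>Hairpins as null-homotopic limits of probes\<close>

lemma hairpin_in_loops:
  assumes "s \<in> {0..1}"
  shows "(\<lambda>t\<in>{0..1}. stem m (s * tent t)) \<in> loops_at Y y0"
proof -
  have "continuous_map (top_of_set {0..1}) (mtopology_of Y) (\<lambda>t. stem m (s * tent t))"
  proof (rule continuous_map_pathin_compose[OF pathin_stem])
    show "continuous_on {0..1} (\<lambda>t. s * tent t)"
      by (intro continuous_intros continuous_tent)
    show "(\<lambda>t. s * tent t) ` {0..1} \<subseteq> {0..1}"
    proof clarify
      fix t :: real assume "t \<in> {0..1}"
      then show "s * tent t \<in> {0..1}"
        using assms tent_in[of t] mult_le_one[of s "tent t"] by simp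
    qed
  qed
  then have "pathin (mtopology_of Y) (\<lambda>t\<in>{0..1}. stem m (s * tent t))"
    unfolding pathin_def by (rule continuous_map_eq) auto
  then show ?thesis
    by (simp add: loops_at_def) (simp add: tent_def stem_0)
qed

text \<open>Scaling the stem parameter by \<open>s\<close> draws the hairpin back to
  \<open>y0\<close>; as \<open>tent\<close> is at most 1, the motion is uniform in
  \<open>t\<close>.\<close>

lemma hairpin_null_homotopic:
  "path_component_of (loop_space Y y0) (\<lambda>t\<in>{0..1}. y0) (\<lambda>t\<in>{0..1}. stem m (tent t))"
proof -
  have "pathin (loop_space Y y0) (\<lambda>s. \<lambda>t\<in>{0..1}. stem m (s * tent t))"
  proof (rule pathin_loop_spaceI[OF hairpin_in_loops])
    fix e :: real assume "e > 0"
    then obtain d where d: "d > 0"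
      "\<And>s t. \<lbrakk>s \<in> {0..1}; t \<in> {0..1}; \<bar>s - t\<bar> < d\<rbrakk> \<Longrightarrow> mdist Y (stem m s) (stem m t) < e"
      using pathin_uniformly_continuous[OF pathin_stem] by metis
    have "mdist Y (stem m (s * tent t)) (stem m (s' * tent t)) < e"
      if "s \<in> {0..1}" "s' \<in> {0..1}" "t \<in> {0..1}" "\<bar>s - s'\<bar> < d" for s s' t
    proof (rule d(2))
      have "\<bar>s * tent t - s' * tent t\<bar> = \<bar>s - s'\<bar> * tent t"
        using tent_in[OF that(3)] by (simp add: abs_mult flip: left_diff_distrib)
      also have "\<dots> \<le> \<bar>s - s'\<bar> * 1"
        using tent_in[OF that(3)] by (intro mult_left_mono) auto
      finally show "\<bar>s * tent t - s' * tent t\<bar> < d"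
        using that by simp
    qed (use that tent_in[OF that(3)] in \<open>auto intro!: mult_le_one\<close>)
    with d(1) show "\<exists>d>0. \<forall>s\<in>{0..1}. \<forall>s'\<in>{0..1}. \<bar>s - s'\<bar> < d \<longrightarrow>
       (\<forall>t\<in>{0..1}. mdist Y ((\<lambda>t\<in>{0..1}. stem m (s * tent t)) t) ((\<lambda>t\<in>{0..1}. stem m (s' * tent t)) t) < e)"
      by (intro exI[of _ d]) auto
  qed
  then show ?thesis
    unfolding path_component_of_def by (rule_tac exI) (auto simp: stem_0)
qed

text \<open>The two loops differ only in the middle third, where the hairpin rests at the wedge
  point while the probe runs round \<open>\<beta> n\<close>.\<close>

lemma probe_tendsto_hairpin:
  assumes "e > 0"
  shows "\<forall>\<^sub>F n in sequentially. \<forall>t\<in>{0..1}. mdist Y ((\<lambda>t\<in>{0..1}. stem m (tent t)) t) (probe m n t) < e"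
  using \<beta>_small[OF assms]
proof eventually_elim
  case (elim n)
  show ?case
  proof
    interpret M: Metric_space "mspace Y" "mdist Y"
      by (rule Metric_space_mspace_mdist)
    fix t :: real assume t: "t \<in> {0..1}"
    show "mdist Y ((\<lambda>t\<in>{0..1}. stem m (tent t)) t) (probe m n t) < e"
      using t
    proof (rule probe_cases[of t m n])
      assume A: "probe m n t = \<beta> n (3 * t - 1)" "tent t = 1" "max 0 (min 1 (3 * t - 1)) = 3 * t - 1"
      have "max 0 (min 1 (3 * t - 1)) \<in> {0..1}"
        by auto
      then have "3 * t - 1 \<in> {0..1}"
        unfolding A(3) .
      then show ?thesis
        using A t elim by (simp add: stem_1)
    qed (use t assms stem_in[OF tent_in[OF t], of m] in simp_all)
  qed
qed

section \<open>Non-metrizability of the quotient topology\<close>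

theorem not_metrizable_pi1_top: "\<not> metrizable_space (pi1_top Y y0)"
proof
  assume met: "metrizable_space (pi1_top Y y0)"
  then obtain M d where "Metric_space M d" and X: "pi1_top Y y0 = Metric_space.mtopology M d"
    unfolding metrizable_space_def by blast
  then interpret P: Metric_space M d
    by simp
  let ?L = "loop_space Y y0"
  let ?cls = "\<lambda>f. path_component_of_set ?L f"
  let ?one = "\<lambda>t\<in>{0..1}. y0"
  have M: "M = path_components_of ?L"
    using X by (metis P.topspace_mtopology topspace_pi1_top)
  have cls_M: "?cls f \<in> M" if "f \<in> loops_at Y y0" for f
    using that by (simp add: M path_component_in_path_components_of)
  have cls_eq: "?cls f = ?cls g \<longleftrightarrow> path_component_of ?L f g" if "f \<in> loops_at Y y0" for f g
    using path_component_of_eq[of ?L f g] that path_component_in_topspace[of ?L f g]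
    by (auto simp: Collect_inj)
  have preimage: "uniform_open Y y0 {f \<in> loops_at Y y0. ?cls f \<in> W}" if "openin P.mtopology W" for W
  proof -
    have "pi1_open Y y0 W"
      using that unfolding X[symmetric] openin_pi1_top .
    then show ?thesis
      unfolding pi1_open_def openin_loop_space topspace_loop_space by blast
  qed
  have one: "?one \<in> loops_at Y y0"
    using path_component_in_topspace[OF hairpin_null_homotopic] by auto
  \<comment> \<open>For fixed \<open>m\<close> the probes converge uniformly to a hairpin of class
    \<open>?cls ?one\<close>, and the loops with class in the ball form a uniformly open
    set.\<close>
  have "\<exists>n. ?cls (probe m n) \<in> P.mball (?cls ?one) (1 / real (Suc m))" for m
  proof -
    let ?hp = "\<lambda>t\<in>{0..1}. stem m (tent t)"
    have hp: "?hp \<in> loops_at Y y0" "?cls ?hp = ?cls ?one"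
      using path_component_in_topspace[OF hairpin_null_homotopic] cls_eq[OF one, of ?hp]
        hairpin_null_homotopic by auto
    let ?W = "{f \<in> loops_at Y y0. ?cls f \<in> P.mball (?cls ?one) (1 / real (Suc m))}"
    have "?hp \<in> ?W"
      using hp cls_M[OF one] by auto
    then obtain e where e: "e > 0"
      "\<And>f. \<lbrakk>f \<in> loops_at Y y0; \<forall>t\<in>{0..1}. mdist Y (?hp t) (f t) < e\<rbrakk> \<Longrightarrow> f \<in> ?W"
      using preimage[OF P.openin_mball] unfolding uniform_open_def by meson
    obtain n where "\<forall>t\<in>{0..1}. mdist Y (?hp t) (probe m n t) < e"
      using probe_tendsto_hairpin[OF e(1)] eventually_happens'[OF sequentially_bot] by blast
    then show ?thesis
      using e(2)[OF probe_in_loops] by blast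
  qed
  then obtain n where n: "\<And>m. ?cls (probe m (n m)) \<in> P.mball (?cls ?one) (1 / real (Suc m))"
    by metis
  \<comment> \<open>Tails of the chosen sequence of classes. A closed tail that misses
    \<open>?cls ?one\<close> contradicts convergence to that class.\<close>
  define S where "S k = {?cls (probe m (n m)) | m. m \<ge> k}" for k
  \<comment> \<open>\<open>e\<close> and \<open>N\<close> depend on \<open>g\<close> alone: the
    angles of all loops near \<open>g\<close> are bounded by \<open>B\<close>, so the levels
    \<open>2 pi m\<close> with \<open>m \<ge> N > B\<close> are out of reach for each of
    them.\<close>
  have far: "\<exists>e>0. \<exists>N. \<forall>f\<in>loops_at Y y0. (\<forall>t\<in>{0..1}. mdist Y (g t) (f t) < e) \<longrightarrow>
               (\<forall>m\<ge>N. ?cls f \<noteq> ?cls (probe m (n m)))"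
    if g: "g \<in> loops_at Y y0" for g
  proof -
    obtain e B where e: "e > 0"
      "\<And>f. \<lbrakk>f \<in> loops_at Y y0; \<forall>t\<in>{0..1}. mdist Y (g t) (f t) < e\<rbrakk> \<Longrightarrow>
       \<exists>\<theta>. continuous_on {0..1} \<theta> \<and> (\<forall>t\<in>{0..1}. exp (\<theta> t) = u (f t)) \<and> \<theta> 0 = base_lift 0 \<and>
           (\<forall>t\<in>{0..1}. norm (\<theta> t) \<le> B)"
      using bounded_lift_near_loop[OF g] by metis
    obtain N :: nat where N: "B < real N"
      using reals_Archimedean2 by blast
    have "?cls f \<noteq> ?cls (probe m (n m))"
      if f: "f \<in> loops_at Y y0" "\<forall>t\<in>{0..1}. mdist Y (g t) (f t) < e" and m: "m \<ge> N" for f m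
    proof
      assume "?cls f = ?cls (probe m (n m))"
      then have hom: "path_component_of ?L (probe m (n m)) f"
        using cls_eq[OF probe_in_loops, of m "n m" f] by simp
      obtain \<theta> where \<theta>: "continuous_on {0..1} \<theta>" "\<And>t. t \<in> {0..1} \<Longrightarrow> exp (\<theta> t) = u (f t)"
        "\<theta> 0 = base_lift 0" "\<And>t. t \<in> {0..1} \<Longrightarrow> norm (\<theta> t) \<le> B"
        using e(2)[OF f] by blast
      have "real m * 1 \<le> real m * (2 * pi)"
        using pi_gt3 by (intro mult_left_mono) auto
      then have "B < norm (complex_of_real (2 * pi * real m) * \<i>)"
        using N m by (simp add: norm_mult mult_ac)
      then show False
        using probe_not_homotopic[OF hom \<theta>(1,2,3)] \<theta>(4) by fastforce
    qed
    with e(1) show ?thesis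
      by blast
  qed
  \<comment> \<open>Openness is tested on loops. Near \<open>g\<close> only members of the tail with
    index in \<open>{k..<N}\<close> could occur; they are finitely many, hence form a closed set in
    the T1 space, and a smaller radius avoids them.\<close>
  have closed: "openin P.mtopology (M - S k)" for k
  proof -
    have "uniform_open Y y0 {f \<in> loops_at Y y0. ?cls f \<in> M - S k}"
      unfolding uniform_open_def
    proof (intro conjI ballI)
      fix g assume g: "g \<in> {f \<in> loops_at Y y0. ?cls f \<in> M - S k}"
      then obtain e N where e: "e > 0" "\<And>f m. \<lbrakk>f \<in> loops_at Y y0;
          \<forall>t\<in>{0..1}. mdist Y (g t) (f t) < e; m \<ge> N\<rbrakk> \<Longrightarrow> ?cls f \<noteq> ?cls (probe m (n m))"
        using far[of g] by blast
      let ?F = "(\<lambda>m. ?cls (probe m (n m))) ` {k..<N}"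
      have "closedin P.mtopology ?F"
      proof -
        have "finite ?F" "?F \<subseteq> M"
          using cls_M[OF probe_in_loops] by auto
        then show ?thesis
          using metrizable_imp_t1_space[OF met] unfolding X t1_space_closedin_finite P.topspace_mtopology
          by blast
      qed
      then have "openin P.mtopology (M - ?F)"
        using openin_diff[OF openin_topspace] by force
      note W = preimage[OF this, unfolded uniform_open_def, THEN conjunct2]
      have "g \<in> {f \<in> loops_at Y y0. ?cls f \<in> M - ?F}"
        using g by (auto simp: S_def)
      from bspec[OF W this] obtain e' where e': "e' > 0"
        "\<forall>f\<in>loops_at Y y0. (\<forall>t\<in>{0..1}. mdist Y (g t) (f t) < e') \<longrightarrow>
           f \<in> {f \<in> loops_at Y y0. ?cls f \<in> M - ?F}"
        by blast
      have "?cls f \<in> M - S k"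
        if f: "f \<in> loops_at Y y0" "\<forall>t\<in>{0..1}. mdist Y (g t) (f t) < min e e'" for f
      proof -
        have "?cls f \<notin> ?F"
          using e'(2) f by simp
        then have "?cls f \<noteq> ?cls (probe m (n m))" if "m \<ge> k" for m
          using e(2)[OF f(1), of m] f(2) that by (cases "m \<ge> N") auto
        then show ?thesis
          using cls_M[OF f(1)] by (auto simp: S_def)
      qed
      with e(1) e'(1) show "\<exists>e>0. \<forall>f\<in>loops_at Y y0. (\<forall>t\<in>{0..1}. mdist Y (g t) (f t) < e) \<longrightarrow>
          f \<in> {f \<in> loops_at Y y0. ?cls f \<in> M - S k}"
        by (intro exI[of _ "min e e'"]) auto
    qed auto
    then have "pi1_open Y y0 (M - S k)"
      unfolding pi1_open_def openin_loop_space topspace_loop_space M[symmetric] by blast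
    then show ?thesis
      unfolding X[symmetric] openin_pi1_top .
  qed
  have y0: "y0 \<in> mspace Y"
    using loops_at_D(4)[OF one, of 0] by simp
  \<comment> \<open>Taking the constant loop as its own neighbour shows that its class misses the
    tail from \<open>N\<close> on.\<close>
  obtain e N where e: "e > 0" "\<forall>f\<in>loops_at Y y0. (\<forall>t\<in>{0..1}. mdist Y (?one t) (f t) < e) \<longrightarrow>
      (\<forall>m\<ge>N. ?cls f \<noteq> ?cls (probe m (n m)))"
    using far[OF one] by blast
  have "mdist Y y0 y0 = 0"
    by (rule Metric_space.mdist_zero[OF Metric_space_mspace_mdist y0])
  then have "\<forall>t\<in>{0..1}. mdist Y (?one t) (?one t) < e"
    using e(1) by simp
  then have "\<forall>m\<ge>N. ?cls ?one \<noteq> ?cls (probe m (n m))"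
    using e(2) one by blast
  then have "?cls ?one \<in> M - S N"
    using cls_M[OF one] by (auto simp: S_def)
  then obtain r where r: "r > 0" "P.mball (?cls ?one) r \<subseteq> M - S N"
    using closed[of N] unfolding P.openin_mtopology by blast
  obtain k where "inverse (real (Suc k)) < r"
    using reals_Archimedean[OF r(1)] by blast
  \<comment> \<open>The index \<open>k + N\<close> is large enough both to belong to the tail
    \<open>S N\<close> and to bring the class within \<open>r\<close> of the identity.\<close>
  moreover have "1 / real (Suc (k + N)) \<le> inverse (real (Suc k))"
    by (simp add: inverse_eq_divide frac_le)
  ultimately have "?cls (probe (k + N) (n (k + N))) \<in> P.mball (?cls ?one) r"
    using n[of "k + N"] by auto
  then show False
    using r(2) unfolding S_def by force
qed

end

subsection \<open>Circles of the Hawaiian earring\<close>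

text \<open>The factor max 0 (1 - ...) is 1 on the n-th circle and 0 on the others: on the k-th circle
  without the origin the quotient equals k. At the origin it is 0 / 0 = 0, which is harmless.\<close>
definition circle_proj :: "nat \<Rightarrow> real \<times> real \<Rightarrow> complex" where
  "circle_proj n z = 1 - complex_of_real
     (real n * max 0 (1 - \<bar>2 * fst z / ((fst z)\<^sup>2 + (snd z)\<^sup>2) - real n\<bar>)) * Complex (fst z) (snd z)"

text \<open>The signs are chosen so that, for \<open>n \<ge> 1\<close>, the map
  \<open>1 - n z\<close> turns the loop into \<open>exp (2 pi i x)\<close>; it starts at the origin,
  the wedge point.\<close>

definition circle_loop :: "nat \<Rightarrow> real \<Rightarrow> real \<times> real" where
  "circle_loop n x = ((1 - cos (2 * pi * x)) / real n, - sin (2 * pi * x) / real n)"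

lemma mem_earring_circle_iff:
  assumes "n \<ge> 1"
  shows "z \<in> sphere (1 / real n, 0) (1 / real n) \<longleftrightarrow> real n * ((fst z)\<^sup>2 + (snd z)\<^sup>2) = 2 * fst z"
proof -
  have "z \<in> sphere (1 / real n, 0) (1 / real n) \<longleftrightarrow>
      sqrt ((1 / real n - fst z)\<^sup>2 + (snd z)\<^sup>2) = sqrt ((1 / real n)\<^sup>2)"
    using assms by (cases z) (simp add: dist_Pair_Pair dist_real_def)
  also have "\<dots> \<longleftrightarrow> (1 / real n - fst z)\<^sup>2 + (snd z)\<^sup>2 = (1 / real n)\<^sup>2"
    by (rule real_sqrt_eq_iff)
  also have "\<dots> \<longleftrightarrow> real n * ((fst z)\<^sup>2 + (snd z)\<^sup>2) = 2 * fst z"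
    using assms by (simp add: power2_diff) (auto simp: field_simps power2_eq_square)
  finally show ?thesis .
qed

lemma hawaiian_earringE:
  assumes "z \<in> hawaiian_earring"
  obtains n where "n \<ge> 1" "real n * ((fst z)\<^sup>2 + (snd z)\<^sup>2) = 2 * fst z"
proof -
  obtain n :: nat where "n \<ge> 1" "z \<in> sphere (1 / real n, 0) (1 / real n)"
    using assms unfolding hawaiian_earring_def by blast
  then show thesis
    using that mem_earring_circle_iff by blast
qed

lemma circle_loop_on_circle:
  assumes "n \<ge> 1"
  shows "real n * ((fst (circle_loop n x))\<^sup>2 + (snd (circle_loop n x))\<^sup>2) = 2 * fst (circle_loop n x)"
proof -
  have "(1 - cos (2 * pi * x))\<^sup>2 + (sin (2 * pi * x))\<^sup>2 = 2 * (1 - cos (2 * pi * x))"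
    using sin_cos_squared_add[of "2 * pi * x"] by (simp add: power2_diff)
  then show ?thesis
    using assms
    by (simp add: circle_loop_def power_divide power2_eq_square[of "real n"] flip: add_divide_distrib)
qed

lemma circle_loop_in_earring: "n \<ge> 1 \<Longrightarrow> circle_loop n x \<in> hawaiian_earring"
  unfolding hawaiian_earring_def
  by (rule UN_I[of n]) (simp, blast intro: mem_earring_circle_iff[THEN iffD2] circle_loop_on_circle)

lemma circle_loop_nat: "circle_loop n (real m) = 0"
proof -
  have *: "2 * pi * real m = 2 * real m * pi"
    by simp
  show ?thesis
    unfolding circle_loop_def * cos_2npi sin_2npi by (simp add: zero_prod_def)
qed

lemma continuous_circle_loop: "continuous_on S (circle_loop n)"
  unfolding circle_loop_def by (cases "n = 0") (auto intro!: continuous_intros)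

lemma norm_circle_loop_le: "norm (circle_loop n x) \<le> 3 / real n"
proof -
  have "norm (circle_loop n x) \<le> \<bar>1 - cos (2 * pi * x)\<bar> / real n + \<bar>sin (2 * pi * x)\<bar> / real n"
    using norm_Pair_le[of "(1 - cos (2 * pi * x)) / real n" "- sin (2 * pi * x) / real n"]
    by (simp add: circle_loop_def)
  also have "\<dots> \<le> 2 / real n + 1 / real n"
    using cos_ge_minus_one[of "2 * pi * x"] cos_le_one[of "2 * pi * x"]
    by (intro add_mono divide_right_mono) auto
  finally show ?thesis
    by (simp flip: add_divide_distrib)
qed

text \<open>Away from the origin the quotient is \<open>k\<close>, and distinct integers differ by
  at least 1, so the cutoff factor is 1 or 0. At the origin both branches give 1.\<close>

lemma circle_proj_on_circle:
  assumes k: "real k * ((fst z)\<^sup>2 + (snd z)\<^sup>2) = 2 * fst z"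
  shows "circle_proj n z = (if k = n then 1 - of_nat n * Complex (fst z) (snd z) else 1)"
proof (cases "(fst z)\<^sup>2 + (snd z)\<^sup>2 = 0")
  case True
  then show ?thesis
    by (simp add: circle_proj_def sum_power2_eq_zero_iff flip: zero_complex.code)
next
  case False
  then have q: "2 * fst z / ((fst z)\<^sup>2 + (snd z)\<^sup>2) = real k"
    using k by (simp add: field_simps)
  have "max 0 (1 - \<bar>real k - real n\<bar>) = (if k = n then 1 else 0)"
    by (auto simp: max_def)
  then show ?thesis
    unfolding circle_proj_def q by simp
qed

text \<open>On its own circle the projection is \<open>1 - n z\<close>; with
  \<open>x = fst z\<close> its squared modulus \<open>1 - 2 n x + n^2 |z|^2\<close> is 1 by the
  circle equation.\<close>

lemma norm_circle_proj:
  assumes "z \<in> hawaiian_earring"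
  shows "norm (circle_proj n z) = 1"
proof -
  obtain k where k: "real k * ((fst z)\<^sup>2 + (snd z)\<^sup>2) = 2 * fst z"
    using hawaiian_earringE[OF assms] by blast
  show ?thesis
  proof (cases "k = n")
    case True
    have "(norm (circle_proj n z))\<^sup>2 = (1 - real n * fst z)\<^sup>2 + (real n * snd z)\<^sup>2"
      unfolding circle_proj_on_circle[OF k] cmod_power2 using True by simp
    also have "\<dots> = 1 - real n * (2 * fst z) + real n * (real n * ((fst z)\<^sup>2 + (snd z)\<^sup>2))"
      by (simp add: power2_eq_square algebra_simps)
    also have "\<dots> = 1"
      using k True by simp
    finally show ?thesis
      by (simp add: power2_eq_1_iff) (smt (verit) norm_ge_zero)
  qed (simp add: circle_proj_on_circle[OF k])
qed

lemma circle_proj_disjoint: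
  assumes "z \<in> hawaiian_earring" "m \<noteq> n"
  shows "circle_proj m z = 1 \<or> circle_proj n z = 1"
proof -
  obtain k where k: "real k * ((fst z)\<^sup>2 + (snd z)\<^sup>2) = 2 * fst z"
    using hawaiian_earringE[OF assms(1)] by blast
  show ?thesis
    using assms(2) by (simp add: circle_proj_on_circle[OF k])
qed

lemma circle_proj_circle_loop:
  assumes "k \<ge> 1"
  shows "circle_proj n (circle_loop k x) = (if k = n then exp (complex_of_real (2 * pi * x) * \<i>) else 1)"
proof -
  have "1 - of_nat k * Complex (fst (circle_loop k x)) (snd (circle_loop k x)) =
      exp (complex_of_real (2 * pi * x) * \<i>)"
    using assms by (simp add: circle_loop_def complex_eq_iff Re_exp Im_exp)
  then show ?thesis
    unfolding circle_proj_on_circle[OF circle_loop_on_circle[OF assms]] by auto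
qed

text \<open>Near the origin the quotient does not converge, but the cutoff factor is at most 1 and
  multiplies a vector that tends to 0, so a squeeze gives the limit 1.\<close>

lemma continuous_circle_proj: "continuous_on S (circle_proj n)"
proof -
  have "isCont (circle_proj n) z" for z
  proof (cases "z = 0")
    case True
    have bound: "norm (circle_proj n y - 1) \<le> real n * norm y" for y
    proof -
      have "norm (circle_proj n y - 1) =
          real n * max 0 (1 - \<bar>2 * fst y / ((fst y)\<^sup>2 + (snd y)\<^sup>2) - real n\<bar>) * norm y"
        by (simp add: circle_proj_def norm_mult complex_norm norm_prod_def)
      also have "\<dots> \<le> real n * 1 * norm y"
        by (intro mult_right_mono mult_left_mono) auto
      finally show ?thesis by simp
    qed
    have "((\<lambda>y :: real \<times> real. real n * norm y) \<longlongrightarrow> real n * norm (0 :: real \<times> real)) (at 0)"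
      by (intro tendsto_mult_left tendsto_norm tendsto_ident_at)
    then have "((\<lambda>y. circle_proj n y - 1) \<longlongrightarrow> 0) (at 0)"
      by (intro Lim_null_comparison[OF always_eventually[OF allI[OF bound]]]) simp
    moreover have "circle_proj n 0 = 1"
      using bound[of 0] by simp
    ultimately show ?thesis
      unfolding True isCont_def by (simp add: LIM_zero_iff)
  next
    case False
    then have "(fst z)\<^sup>2 + (snd z)\<^sup>2 \<noteq> 0"
      by (simp add: sum_power2_eq_zero_iff prod_eq_iff)
    moreover have "isCont (\<lambda>z. Complex (fst z) (snd z)) z"
      unfolding Complex_eq by (intro continuous_intros)
    ultimately show ?thesis
      unfolding circle_proj_def[abs_def] by (intro continuous_intros) auto
  qed
  then show ?thesis
    by (simp add: continuous_at_imp_continuous_on)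
qed

section \<open>From an earring retract to a lamp family\<close>

theorem corollary4:
  fixes Y :: "'a metric" and y0 :: 'a
  assumes "path_connected_space (mtopology_of Y)"
    and "y0 \<in> mspace Y"
    and "metrizable_space (pi1_top Y y0)"
  shows "\<not> (\<exists>A. subtopology (mtopology_of Y) A homeomorphic_space top_of_set hawaiian_earring
                \<and> A retract_of_space mtopology_of Y)"
proof
  assume "\<exists>A. subtopology (mtopology_of Y) A homeomorphic_space top_of_set hawaiian_earring
                \<and> A retract_of_space mtopology_of Y"
  then obtain A h i r where
    hi: "homeomorphic_maps (subtopology (mtopology_of Y) A) (top_of_set hawaiian_earring) h i"
    and A: "A \<subseteq> mspace Y" and r: "continuous_map (mtopology_of Y) (subtopology (mtopology_of Y) A) r"
      "\<And>x. x \<in> A \<Longrightarrow> r x = x"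
    by (auto simp: homeomorphic_space_def retract_of_space_def)
  \<comment> \<open>A left inverse of the embedding \<open>i\<close>, defined on all of
    \<open>Y\<close>.\<close>
  define \<rho> where "\<rho> = h \<circ> r"
  have \<rho>: "continuous_map (mtopology_of Y) (top_of_set hawaiian_earring) \<rho>"
    using continuous_map_compose[OF r(1)] hi unfolding homeomorphic_maps_def \<rho>_def by blast
  then have \<rho>_in: "\<rho> y \<in> hawaiian_earring" if "y \<in> mspace Y" for y
    using that by (auto simp: continuous_map_def)
  have i: "continuous_map (top_of_set hawaiian_earring) (mtopology_of Y) i"
    and i_in: "\<And>z. z \<in> hawaiian_earring \<Longrightarrow> i z \<in> A \<and> h (i z) = z"
    using hi by (auto simp: homeomorphic_maps_def continuous_map_in_subtopology)
  have \<rho>i: "\<rho> (i z) = z" if "z \<in> hawaiian_earring" for z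
    using i_in[OF that] r(2) by (simp add: \<rho>_def)
  have zero: "0 \<in> hawaiian_earring"
    using circle_loop_in_earring[of 1 0] circle_loop_nat[of 1 0] by simp
  have "i 0 \<in> mspace Y"
    using i_in[OF zero] A by auto
  then obtain \<gamma> where \<gamma>: "pathin (mtopology_of Y) \<gamma>" "\<gamma> 0 = y0" "\<gamma> 1 = i 0"
    using assms(1,2) unfolding path_connected_space_def by auto
  have proj: "continuous_map (mtopology_of Y) euclidean (\<lambda>y. circle_proj n (\<rho> y))" for n
    using continuous_map_compose[OF \<rho>, of euclidean "circle_proj n"] continuous_circle_proj
    by (simp add: o_def)
  have loop: "continuous_map (top_of_set T) (mtopology_of Y) (\<lambda>x. i (circle_loop n x))"
    if "n \<ge> 1" for n T
    using continuous_map_compose[of "top_of_set T" "top_of_set hawaiian_earring" "circle_loop n", OF _ i]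
      continuous_circle_loop circle_loop_in_earring[OF that]
    by (auto simp: o_def continuous_map_in_subtopology)
  \<comment> \<open>Continuity of \<open>i\<close> at the origin suffices, since the loops stay
    within distance \<open>3 / (n + 2)\<close> of it.\<close>
  have small: "\<forall>\<^sub>F n in sequentially. \<forall>t\<in>{0..1}. mdist Y (i 0) (i (circle_loop (n + 2) t)) < e"
    if e: "e > 0" for e
  proof -
    interpret M: Metric_space "mspace Y" "mdist Y"
      by (rule Metric_space_mspace_mdist)
    have "openin (top_of_set hawaiian_earring) {z \<in> hawaiian_earring. i z \<in> M.mball (i 0) e}"
      using openin_continuous_map_preimage[OF i, of "M.mball (i 0) e"] by (simp add: mtopology_of_def)
    moreover have "0 \<in> {z \<in> hawaiian_earring. i z \<in> M.mball (i 0) e}"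
      using zero \<open>i 0 \<in> mspace Y\<close> e by simp
    ultimately obtain d where d: "d > 0"
      "\<And>z. \<lbrakk>z \<in> hawaiian_earring; dist z 0 < d\<rbrakk> \<Longrightarrow> i z \<in> M.mball (i 0) e"
      unfolding openin_euclidean_subtopology_iff by blast
    have "(\<lambda>n. 3 / real (n + 2)) \<longlonglongrightarrow> 0"
      using LIMSEQ_ignore_initial_segment[OF lim_const_over_n[of "3::real"], of 2] by simp
    then have "\<forall>\<^sub>F n in sequentially. 3 / real (n + 2) < d"
      using d(1) by (rule order_tendstoD)
    then show ?thesis
    proof eventually_elim
      case (elim n)
      then have "i (circle_loop (n + 2) t) \<in> M.mball (i 0) e" for t
        using norm_circle_loop_le[of "n + 2" t] circle_loop_in_earring[of "n + 2" t] by (intro d(2)) auto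
      then show ?case
        by simp
    qed
  qed
  \<comment> \<open>The shift by 2 keeps the small circles distinct from circle 1 for every
    \<open>n\<close>, including 0.\<close>
  interpret lamp_family Y y0 \<gamma> "\<lambda>x. i (circle_loop 1 x)" "\<lambda>n x. i (circle_loop (n + 2) x)"
    "\<lambda>y. circle_proj 1 (\<rho> y)" "\<lambda>n y. circle_proj (n + 2) (\<rho> y)"
  proof unfold_locales
    show "continuous_map euclideanreal (mtopology_of Y) (\<lambda>x. i (circle_loop 1 x))"
      using loop[of 1 UNIV] by simp
    show "pathin (mtopology_of Y) (\<lambda>x. i (circle_loop (n + 2) x))" for n
      unfolding pathin_def by (rule loop) simp
    show "i (circle_loop 1 (real m)) = \<gamma> 1" for m
      unfolding circle_loop_nat by (simp add: \<gamma>)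
    show "i (circle_loop (n + 2) 0) = \<gamma> 1" "i (circle_loop (n + 2) 1) = \<gamma> 1" for n
      using circle_loop_nat[of "n + 2" 0] circle_loop_nat[of "n + 2" 1] by (simp_all add: \<gamma>)
    show "circle_proj 1 (\<rho> y) = 1 \<or> circle_proj (n + 2) (\<rho> y) = 1" if "y \<in> mspace Y" for y n
      by (rule circle_proj_disjoint[OF \<rho>_in[OF that]]) simp
  qed (use \<gamma> proj small norm_circle_proj \<rho>_in in
       \<open>simp_all add: \<rho>i circle_loop_in_earring circle_proj_circle_loop\<close>)
  show False
    using not_metrizable_pi1_top assms(3) by contradiction
qed

end
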